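(* Let $(X,T)$ be a topological dynamical system, where $X$ is a non-empty compact metric space with metric $d$ and $T:X\to X$ is continuous. If $x,y\in X$ are generic points, then $F(x,y)$ exists, i.e. the limit $$\lim_{n\to+\infty}\ \inf_{\sigma\in S_n}\frac1n\sum_{k=1}^n d(T^kx,T^{\sigma(k)}y)$$ exists.
   Context: $S_n$ denotes the group of permutations of $\{1,\dots,n\}$. $C(X)$ is the space of continuous functions on $X$. A point $x\in X$ is called a generic point if for every $f\in C(X)$ the time average $f^*(x)=\lim_{n\to+\infty}\frac1n\sum_{k=1}^n f(T^kx)$ exists. *)

theory Defs
  imports "HOL-Analysis.Analysis" "HOL-Combinatorics.Permutations"
begin

(* C(X) is taken to be the space of real-valued continuous functions on X. *)
definition generic_point :: "'a::metric_space set \<Rightarrow> ('a \<Rightarrow> 'a) \<Rightarrow> 'a \<Rightarrow> bool" where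
  "generic_point X T x \<longleftrightarrow> x \<in> X \<and>
     (\<forall>f :: 'a \<Rightarrow> real. continuous_on X f \<longrightarrow>
        convergent (\<lambda>n. (1 / real n) * (\<Sum>k=1..n. f ((T ^^ k) x))))"

(* The infimum over S_n ranges over a finite non-empty set; it is a minimum.
   At n = 0 the value is 0, which does not affect the limit. *)
definition F_avg :: "('a::metric_space \<Rightarrow> 'a) \<Rightarrow> 'a \<Rightarrow> 'a \<Rightarrow> nat \<Rightarrow> real" where
  "F_avg T x y n =
     (INF \<sigma>\<in>{\<sigma>. \<sigma> permutes {1..n}}. (1 / real n) * (\<Sum>k=1..n. dist ((T ^^ k) x) ((T ^^ \<sigma> k) y)))"

end

(*
  F_avg is the optimal assignment cost between the first n points of the two orbits.
  By Kantorovich duality it equals the maximum, over 1-Lipschitz f on X, of the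
  difference of the time averages of f along the two orbits.  For each fixed f this
  difference converges by genericity, and modulo additive constants the 1-Lipschitz
  functions on a compact space are totally bounded in the supremum norm; hence the
  maxima form a Cauchy sequence.

  The dual potential comes from cyclic monotonicity: relative to an optimal assignment
  no cycle of exchanges has negative cost, so shortest path lengths are finite and
  serve as a potential.
*)
theory Submission
  imports Defs "HOL-Combinatorics.Cycles"
begin

section \<open>Potentials from shortest paths\<close>

fun path_cost :: "('i \<Rightarrow> 'i \<Rightarrow> real) \<Rightarrow> 'i list \<Rightarrow> real" where
  "path_cost c (i # j # is) = c i j + path_cost c (j # is)"
| "path_cost c _ = 0"

lemma path_cost_split:
  "path_cost c (xs @ i # ys) = path_cost c (xs @ [i]) + path_cost c (i # ys)"
proof (induction xs)
  case (Cons x xs)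
  then show ?case by (cases xs) auto
qed simp

lemma path_cost_snoc_eq:
  "path_cost c (x # xs @ [y]) = sum_list (map2 c (x # xs) (xs @ [y]))"
  by (induction xs arbitrary: x) auto

text \<open>A simple closed path is one cycle of a permutation fixing every other index. The fixed
  indices contribute zero diagonal terms, so the path cost is a full permutation sum.\<close>

lemma path_cost_closed_nonneg:
  fixes c :: "'i \<Rightarrow> 'i \<Rightarrow> real"
  assumes "finite I" and diag: "\<And>i. i \<in> I \<Longrightarrow> c i i = 0"
    and perm: "\<And>\<tau>. \<tau> permutes I \<Longrightarrow> 0 \<le> (\<Sum>i\<in>I. c i (\<tau> i))"
    and cs: "distinct (i # xs)" "set (i # xs) \<subseteq> I"
  shows "0 \<le> path_cost c (i # xs @ [i])"
proof -
  let ?\<tau> = "cycle_of_list (i # xs)"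
  have "?\<tau> permutes I"
    using cycle_permutes cs(2) by (rule permutes_subset)
  then have "0 \<le> (\<Sum>k\<in>I. c k (?\<tau> k))"
    by (rule perm)
  also have "\<dots> = (\<Sum>k\<in>set (i # xs). c k (?\<tau> k))"
    using \<open>finite I\<close> cs(2) by (intro sum.mono_neutral_right) (auto simp: id_outside_supp diag)
  also have "\<dots> = sum_list (map (\<lambda>k. c k (?\<tau> k)) (i # xs))"
    using cs(1) by (simp only: sum_list_distinct_conv_sum_set)
  also have "map (\<lambda>k. c k (?\<tau> k)) (i # xs) = map2 c (i # xs) (map ?\<tau> (i # xs))"
    by (simp add: zip_map2 map_zip_map2 zip_same_conv_map del: cycle_of_list.simps)
  also have "map ?\<tau> (i # xs) = xs @ [i]"
    using cyclic_rotation[OF cs(1), of 1] by simp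
  finally show ?thesis
    by (simp only: path_cost_snoc_eq)
qed

text \<open>The potential is a shortest path length with free endpoint: prepending \<open>i\<close>
  to an optimal path from \<open>j\<close> gives a candidate for \<open>i\<close>, once any loop
  through \<open>i\<close> is removed.\<close>

lemma exists_potential:
  fixes c :: "'i \<Rightarrow> 'i \<Rightarrow> real"
  assumes "finite I" and diag: "\<And>i. i \<in> I \<Longrightarrow> c i i = 0"
    and perm: "\<And>\<tau>. \<tau> permutes I \<Longrightarrow> 0 \<le> (\<Sum>i\<in>I. c i (\<tau> i))"
  obtains \<psi> where "\<And>i j. i \<in> I \<Longrightarrow> j \<in> I \<Longrightarrow> \<psi> i \<le> c i j + \<psi> j"
proof
  define P where "P i = {xs. distinct (i # xs) \<and> set (i # xs) \<subseteq> I}" for i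
  define \<psi> where "\<psi> i = Min ((\<lambda>xs. path_cost c (i # xs)) ` P i)" for i
  have fin: "finite (P i)" for i
    by (rule finite_subset[OF _ finite_subset_distinct[OF \<open>finite I\<close>]]) (auto simp: P_def)
  have le: "\<psi> i \<le> path_cost c (i # xs)" if "xs \<in> P i" for i xs
    unfolding \<psi>_def using fin that by (intro Min_le) auto
  fix i j assume ij: "i \<in> I" "j \<in> I"
  have "[] \<in> P j"
    using ij by (auto simp: P_def)
  then have "\<psi> j \<in> (\<lambda>xs. path_cost c (j # xs)) ` P j"
    unfolding \<psi>_def using fin by (intro Min_in) auto
  then obtain xs where xs: "xs \<in> P j" "\<psi> j = path_cost c (j # xs)"
    by auto
  show "\<psi> i \<le> c i j + \<psi> j"
  proof (cases "i \<in> set (j # xs)")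
    case False
    then have "j # xs \<in> P i"
      using xs(1) ij by (auto simp: P_def)
    from le[OF this] show ?thesis
      using xs(2) by simp
  next
    \<comment> \<open>The optimal path from \<open>j\<close> already visits \<open>i\<close>. Its
      initial segment together with the edge from \<open>i\<close> to \<open>j\<close> is a closed
      path of nonnegative cost; the rest is a simple path from \<open>i\<close>.\<close>
    case True
    then obtain as bs where split: "j # xs = as @ i # bs"
      by (metis split_list)
    have cyc: "distinct (as @ i # bs)" "set (as @ i # bs) \<subseteq> I"
      using xs(1) unfolding P_def split[symmetric] by simp_all
    then have "bs \<in> P i"
      by (auto simp: P_def)
    have "0 \<le> path_cost c (i # as @ [i])"
      using assms cyc by (intro path_cost_closed_nonneg[of I]) auto
    also have "path_cost c (i # as @ [i]) = c i j + path_cost c (as @ [i])"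
      using split diag ij by (cases as) auto
    finally show ?thesis
      using le[OF \<open>bs \<in> P i\<close>] path_cost_split[of c as i bs] xs(2) split by simp
  qed
qed

section \<open>Kantorovich duality for assignments\<close>

text \<open>Strong duality for an optimal assignment normalised to be the identity: \<open>f\<close>
  is tight on every matched pair.\<close>

lemma optimal_assignment_potential:
  fixes u w :: "'i \<Rightarrow> 'a::metric_space"
  assumes "finite I"
    and opt: "\<And>\<tau>. \<tau> permutes I \<Longrightarrow> (\<Sum>i\<in>I. dist (u i) (w i)) \<le> (\<Sum>i\<in>I. dist (u i) (w (\<tau> i)))"
  obtains f :: "'a \<Rightarrow> real"
  where "1-lipschitz_on UNIV f" and "\<And>i. i \<in> I \<Longrightarrow> dist (u i) (w i) \<le> f (u i) - f (w i)"
proof (cases "I = {}")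
  case True
  show ?thesis
    by (rule that[of "\<lambda>_. 0"]) (auto simp: True intro!: lipschitz_onI)
next
  case False
  \<comment> \<open>The change in cost when \<open>u i\<close> is matched with \<open>w j\<close>
    instead of \<open>w i\<close>. Optimality says that its permutation sums are
    nonnegative.\<close>
  define c where "c i j = dist (u i) (w j) - dist (u i) (w i)" for i j
  obtain \<psi> where \<psi>: "\<And>i j. i \<in> I \<Longrightarrow> j \<in> I \<Longrightarrow> \<psi> i \<le> c i j + \<psi> j"
    by (rule exists_potential[OF \<open>finite I\<close>, of c])
       (auto simp: c_def sum_subtractf opt)
  \<comment> \<open>An infimal convolution of the potential with the metric: a minimum of
    1-Lipschitz functions, hence 1-Lipschitz on the whole type.\<close>
  define f where "f z = Min ((\<lambda>i. \<psi> i + dist z (w i)) ` I)" for z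
  have le: "f z \<le> \<psi> i + dist z (w i)" if "i \<in> I" for z i
    unfolding f_def using \<open>finite I\<close> that by (intro Min_le) auto
  have ge: "r \<le> f z" if "\<And>i. i \<in> I \<Longrightarrow> r \<le> \<psi> i + dist z (w i)" for z r
    unfolding f_def using \<open>finite I\<close> False that by (intro Min.boundedI) auto
  have lip: "f z - dist z z' \<le> f z'" for z z'
  proof (rule ge)
    fix i assume "i \<in> I"
    then show "f z - dist z z' \<le> \<psi> i + dist z' (w i)"
      using le[of i z] dist_triangle[of z "w i" z'] by linarith
  qed
  show ?thesis
  proof (rule that)
    show "1-lipschitz_on UNIV f"
    proof (rule lipschitz_onI)
      fix z z' show "dist (f z) (f z') \<le> 1 * dist z z'"
        using lip[of z z'] lip[of z' z] by (simp add: dist_real_def dist_commute)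
    qed simp
    fix i assume "i \<in> I"
    have "\<psi> i + dist (u i) (w i) \<le> f (u i)"
    proof (rule ge)
      fix j assume "j \<in> I"
      then show "\<psi> i + dist (u i) (w i) \<le> \<psi> j + dist (u i) (w j)"
        using \<psi>[OF \<open>i \<in> I\<close>, of j] by (simp add: c_def)
    qed
    moreover have "f (w i) \<le> \<psi> i"
      using le[OF \<open>i \<in> I\<close>, of "w i"] by simp
    ultimately show "dist (u i) (w i) \<le> f (u i) - f (w i)"
      by linarith
  qed
qed

text \<open>Weak duality: reindexing the \<open>v\<close> terms by the permutation leaves their sum
  unchanged, and then the Lipschitz bound applies termwise.\<close>

lemma sum_diff_le_assignment_cost:
  fixes u v :: "'i \<Rightarrow> 'a::metric_space" and f :: "'a \<Rightarrow> real"
  assumes "1-lipschitz_on X f" and "\<And>i. i \<in> I \<Longrightarrow> u i \<in> X" and "\<And>i. i \<in> I \<Longrightarrow> v i \<in> X"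
    and "\<sigma> permutes I"
  shows "(\<Sum>i\<in>I. f (u i) - f (v i)) \<le> (\<Sum>i\<in>I. dist (u i) (v (\<sigma> i)))"
proof -
  have "(\<Sum>i\<in>I. f (u i) - f (v i)) = (\<Sum>i\<in>I. f (u i) - f (v (\<sigma> i)))"
    using sum.permute[OF \<open>\<sigma> permutes I\<close>, of "\<lambda>i. f (v i)"] by (simp add: sum_subtractf)
  also have "\<dots> \<le> (\<Sum>i\<in>I. dist (u i) (v (\<sigma> i)))"
  proof (rule sum_mono)
    fix i assume i: "i \<in> I"
    then have "\<sigma> i \<in> I"
      using \<open>\<sigma> permutes I\<close> by (simp add: permutes_in_image)
    then have "dist (f (u i)) (f (v (\<sigma> i))) \<le> 1 * dist (u i) (v (\<sigma> i))"
      using i assms by (intro lipschitz_onD[of _ X]) auto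
    then show "f (u i) - f (v (\<sigma> i)) \<le> dist (u i) (v (\<sigma> i))"
      by (simp add: dist_real_def)
  qed
  finally show ?thesis .
qed

text \<open>The dual objective: for positive \<open>n\<close>, the integral of \<open>f\<close>
  against the difference of the two empirical measures.\<close>

definition avg_diff :: "(nat \<Rightarrow> 'a) \<Rightarrow> (nat \<Rightarrow> 'a) \<Rightarrow> ('a \<Rightarrow> real) \<Rightarrow> nat \<Rightarrow> real" where
  "avg_diff u v f n = (1 / real n) * (\<Sum>k=1..n. f (u k) - f (v k))"

lemma F_avg_duality:
  fixes T :: "'a::metric_space \<Rightarrow> 'a"
  defines "u \<equiv> \<lambda>x k. (T ^^ k) x"
  assumes X: "\<And>k. u x k \<in> X" "\<And>k. u y k \<in> X"
  shows avg_diff_le_F_avg: "1-lipschitz_on X f \<Longrightarrow> avg_diff (u x) (u y) f n \<le> F_avg T x y n"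
    and F_avg_attained: "\<exists>f. 1-lipschitz_on X f \<and> F_avg T x y n \<le> avg_diff (u x) (u y) f n"
proof -
  let ?S = "{\<sigma>. \<sigma> permutes {1..n}}"
  define cost where "cost \<sigma> = (1 / real n) * (\<Sum>k=1..n. dist (u x k) (u y (\<sigma> k)))" for \<sigma>
  have fin: "finite ?S" and ne: "?S \<noteq> {}"
    using permutes_id[of "{1..n}"] by (auto simp: finite_permutations simp del: permutes_id)
  have F: "F_avg T x y n = Min (cost ` ?S)"
    unfolding F_avg_def cost_def u_def using fin ne by (intro cInf_eq_Min) auto
  show "avg_diff (u x) (u y) f n \<le> F_avg T x y n" if "1-lipschitz_on X f"
    unfolding F using fin ne that X
    by (auto simp: cost_def avg_diff_def
        intro!: Min.boundedI mult_left_mono divide_right_mono sum_diff_le_assignment_cost[of X])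
  have "Min (cost ` ?S) \<in> cost ` ?S"
    using fin ne by (intro Min_in) auto
  then obtain \<sigma> where \<sigma>: "\<sigma> permutes {1..n}" "cost \<sigma> = Min (cost ` ?S)"
    by auto
  show "\<exists>f. 1-lipschitz_on X f \<and> F_avg T x y n \<le> avg_diff (u x) (u y) f n"
  proof (cases "n = 0")
    case True
    then show ?thesis
      unfolding F \<sigma>(2)[symmetric]
      by (intro exI[of _ "\<lambda>_. 0"]) (auto simp: cost_def avg_diff_def intro!: lipschitz_onI)
  next
    case False
    \<comment> \<open>Relabelling the targets by the optimal \<open>\<sigma>\<close> makes the
      identity optimal, since each rearrangement \<open>\<tau>\<close> corresponds to the competitor
      \<open>\<sigma> \<circ> \<tau>\<close>.\<close>
    have "(\<Sum>k=1..n. dist (u x k) (u y (\<sigma> k))) \<le> (\<Sum>k=1..n. dist (u x k) (u y (\<sigma> (\<tau> k))))"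
      if "\<tau> permutes {1..n}" for \<tau>
    proof -
      have "cost \<sigma> \<le> cost (\<sigma> \<circ> \<tau>)"
        unfolding \<sigma>(2) using fin permutes_compose[OF that \<sigma>(1)] by (intro Min_le) auto
      then show ?thesis
        using False by (simp add: cost_def divide_le_cancel)
    qed
    then obtain f :: "'a \<Rightarrow> real" where f: "1-lipschitz_on UNIV f"
      "\<And>k. k \<in> {1..n} \<Longrightarrow> dist (u x k) (u y (\<sigma> k)) \<le> f (u x k) - f (u y (\<sigma> k))"
      using optimal_assignment_potential[of "{1..n}" "u x" "\<lambda>k. u y (\<sigma> k)"] by auto
    have "(\<Sum>k=1..n. dist (u x k) (u y (\<sigma> k))) \<le> (\<Sum>k=1..n. f (u x k) - f (u y (\<sigma> k)))"
      by (rule sum_mono) (rule f(2))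
    also have "\<dots> = (\<Sum>k=1..n. f (u x k) - f (u y k))"
      using sum.permute[OF \<sigma>(1), of "\<lambda>k. f (u y k)"] by (simp add: sum_subtractf)
    finally have "cost \<sigma> \<le> avg_diff (u x) (u y) f n"
      unfolding cost_def avg_diff_def by (intro mult_left_mono) auto
    moreover have "1-lipschitz_on X f"
      using f(1) by (rule lipschitz_on_subset) simp
    ultimately show ?thesis
      unfolding F using \<sigma>(2) by auto
  qed
qed

section \<open>Total boundedness of Lipschitz functions\<close>

text \<open>Closeness is measured modulo additive constants, since otherwise the family is
  unbounded. Rounded values on a finite net leave finitely many classes, and one representative of
  each suffices.\<close>

lemma lipschitz_functions_totally_bounded:
  fixes X :: "'a::metric_space set"
  assumes "compact X" and "0 < e"
  obtains G :: "('a \<Rightarrow> real) set"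
  where "finite G" and "\<And>g. g \<in> G \<Longrightarrow> 1-lipschitz_on X g"
    and "\<And>f. 1-lipschitz_on X f \<Longrightarrow>
      \<exists>g\<in>G. \<forall>z\<in>X. \<forall>w\<in>X. \<bar>(f z - g z) - (f w - g w)\<bar> \<le> e"
proof (cases "X = {}")
  case True
  show ?thesis
    by (rule that[of "{\<lambda>_. 0}"]) (auto simp: True)
next
  case False
  then obtain p where p: "p \<in> X" by auto
  \<comment> \<open>Each of \<open>z\<close> and \<open>w\<close> costs \<open>3 * d\<close>: one
    \<open>d\<close> for rounding at a net point, and one for moving each of \<open>f\<close> and
    \<open>g\<close> there.\<close>
  define d where "d = e / 6"
  have "0 < d" using \<open>0 < e\<close> by (simp add: d_def)
  obtain C where C: "finite C" "C \<subseteq> X" "X \<subseteq> (\<Union>c\<in>C. ball c d)"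
    using seq_compact_imp_totally_bounded[of X] \<open>compact X\<close> \<open>0 < d\<close>
    by (metis compact_imp_seq_compact)
  obtain D where D: "\<And>z. z \<in> X \<Longrightarrow> dist p z \<le> D"
    using compact_imp_bounded[OF \<open>compact X\<close>] bounded_any_center[of X p] by auto
  define L where "L = {f :: 'a \<Rightarrow> real. 1-lipschitz_on X f}"
  have lip: "\<bar>f z - f w\<bar> \<le> dist z w" if "f \<in> L" "z \<in> X" "w \<in> X" for f z w
    using that lipschitz_onD[of 1 X f z w] by (simp add: L_def dist_real_def)
  \<comment> \<open>Subtracting \<open>f p\<close> bounds the values by \<open>D\<close>. The
    restriction to \<open>C\<close> places codes in a finite extensional function space.\<close>
  define code where "code f = restrict (\<lambda>c. \<lfloor>(f c - f p) / d\<rfloor>) C" for f :: "'a \<Rightarrow> real"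
  have "code ` L \<subseteq> C \<rightarrow>\<^sub>E {\<lfloor>- D / d\<rfloor>..\<lfloor>D / d\<rfloor>}"
  proof (rule image_subsetI)
    fix f assume "f \<in> L"
    have "\<bar>f c - f p\<bar> \<le> D" if "c \<in> C" for c
      using lip[OF \<open>f \<in> L\<close>, of c p] D[of c] C(2) that p by (force simp: dist_commute)
    then have "- D \<le> f c - f p \<and> f c - f p \<le> D" if "c \<in> C" for c
      using that by (force simp: abs_le_iff)
    then show "code f \<in> C \<rightarrow>\<^sub>E {\<lfloor>- D / d\<rfloor>..\<lfloor>D / d\<rfloor>}"
      using \<open>0 < d\<close> unfolding code_def
      by (auto intro!: floor_mono simp: divide_simps)
  qed
  then have fin: "finite (code ` L)"
    by (rule finite_subset) (intro finite_PiE C(1) finite_atLeastAtMost_int)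
  show ?thesis
  proof (rule that)
    show "finite (inv_into L code ` code ` L)"
      using fin by simp
    show "1-lipschitz_on X g" if "g \<in> inv_into L code ` code ` L" for g
      using that inv_into_into[of _ code L] by (auto simp: L_def)
    fix f :: "'a \<Rightarrow> real" assume "1-lipschitz_on X f"
    then have "f \<in> L" by (simp add: L_def)
    define g where "g = inv_into L code (code f)"
    have "g \<in> L" and code: "code g = code f"
      unfolding g_def using \<open>f \<in> L\<close> by (simp_all add: inv_into_into f_inv_into_f)
    have net: "\<bar>(f c - f p) - (g c - g p)\<bar> \<le> d" if "c \<in> C" for c
    proof -
      have "\<lfloor>(f c - f p) / d\<rfloor> = \<lfloor>(g c - g p) / d\<rfloor>"
        using fun_cong[OF code, of c] that by (simp add: code_def)
      then have "\<bar>(f c - f p) / d - (g c - g p) / d\<bar> \<le> 1"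
        by linarith
      then show ?thesis
        using \<open>0 < d\<close> by (simp add: diff_divide_distrib[symmetric] divide_le_eq)
    qed
    have near: "\<bar>(f z - f p) - (g z - g p)\<bar> \<le> 3 * d" if z: "z \<in> X" for z
    proof -
      obtain c where c: "c \<in> C" "dist c z < d"
        using C(3) z by auto
      then have "\<bar>f c - f z\<bar> \<le> d" "\<bar>g c - g z\<bar> \<le> d"
        using lip[OF \<open>f \<in> L\<close>, of c z] lip[OF \<open>g \<in> L\<close>, of c z] C(2) z by force+
      with net[OF c(1)] show ?thesis by linarith
    qed
    have "\<forall>z\<in>X. \<forall>w\<in>X. \<bar>(f z - g z) - (f w - g w)\<bar> \<le> e"
    proof (intro ballI)
      fix z w assume "z \<in> X" "w \<in> X"
      then show "\<bar>(f z - g z) - (f w - g w)\<bar> \<le> e"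
        using near[of z] near[of w] unfolding d_def by linarith
    qed
    then show "\<exists>g\<in>inv_into L code ` code ` L. \<forall>z\<in>X. \<forall>w\<in>X. \<bar>(f z - g z) - (f w - g w)\<bar> \<le> e"
      using \<open>f \<in> L\<close> unfolding g_def by blast
  qed
qed

section \<open>Convergence\<close>

text \<open>Additive constants cancel in \<open>avg_diff\<close>, so a bound on the oscillation of
  \<open>f - g\<close> is enough.\<close>

lemma avg_diff_close:
  assumes "\<And>k. u k \<in> X" "\<And>k. v k \<in> X" "0 \<le> e"
    and "\<forall>z\<in>X. \<forall>w\<in>X. \<bar>(f z - g z) - (f w - g w)\<bar> \<le> e"
  shows "\<bar>avg_diff u v f n - avg_diff u v g n\<bar> \<le> e"
proof (cases "n = 0")
  case False
  have "\<bar>\<Sum>k=1..n. (f (u k) - f (v k)) - (g (u k) - g (v k))\<bar>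
      \<le> (\<Sum>k=1..n. \<bar>(f (u k) - f (v k)) - (g (u k) - g (v k))\<bar>)"
    by (rule sum_abs)
  also have "\<dots> \<le> (\<Sum>k=1..n. e)"
  proof (rule sum_mono)
    fix k
    have "\<bar>(f (u k) - g (u k)) - (f (v k) - g (v k))\<bar> \<le> e"
      using assms by blast
    then show "\<bar>(f (u k) - f (v k)) - (g (u k) - g (v k))\<bar> \<le> e"
      by linarith
  qed
  finally have "\<bar>\<Sum>k=1..n. (f (u k) - f (v k)) - (g (u k) - g (v k))\<bar> \<le> real n * e"
    by simp
  moreover have "avg_diff u v f n - avg_diff u v g n
      = (\<Sum>k=1..n. (f (u k) - f (v k)) - (g (u k) - g (v k))) / real n"
    unfolding avg_diff_def
    by (simp add: sum_subtractf[of "\<lambda>k. f (u k) - f (v k)"] diff_divide_distrib del: sum_subtractf)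
  ultimately show ?thesis
    using False by (simp add: divide_le_eq mult.commute)
qed (use \<open>0 \<le> e\<close> in \<open>simp add: avg_diff_def\<close>)

theorem theorem1p1:
  fixes X :: "'a::metric_space set" and T :: "'a \<Rightarrow> 'a" and x y :: 'a
  assumes "X \<noteq> {}" and "compact X"
    and "continuous_on X T" and "T ` X \<subseteq> X"
    and "generic_point X T x" and "generic_point X T y"
  shows "convergent (F_avg T x y)"
proof -
  let ?A = "avg_diff (\<lambda>k. (T ^^ k) x) (\<lambda>k. (T ^^ k) y)"
  have orbit: "(T ^^ k) z \<in> X" if "z \<in> X" for z k
    using that \<open>T ` X \<subseteq> X\<close> by (induction k) auto
  have xy: "(T ^^ k) x \<in> X" "(T ^^ k) y \<in> X" for k
    using assms(5,6) by (auto simp: generic_point_def intro: orbit)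
  have conv: "convergent (?A g)" if "1-lipschitz_on X g" for g
  proof -
    have "continuous_on X g"
      using that by (rule lipschitz_on_continuous_on)
    then have "convergent (\<lambda>n. (1 / real n) * (\<Sum>k=1..n. g ((T ^^ k) x))
        - (1 / real n) * (\<Sum>k=1..n. g ((T ^^ k) y)))"
      using assms(5,6) unfolding generic_point_def by (intro convergent_diff) auto
    then show ?thesis
      unfolding avg_diff_def by (simp add: sum_subtractf diff_divide_distrib)
  qed
  have "Cauchy (F_avg T x y)"
  proof (rule metric_CauchyI)
    fix e :: real assume "0 < e"
    define d where "d = e / 4"
    have "0 < d" using \<open>0 < e\<close> by (simp add: d_def)
    obtain G where G: "finite G" "\<And>g. g \<in> G \<Longrightarrow> 1-lipschitz_on X g"
      "\<And>f. 1-lipschitz_on X f \<Longrightarrow> \<exists>g\<in>G. \<forall>z\<in>X. \<forall>w\<in>X. \<bar>(f z - g z) - (f w - g w)\<bar> \<le> d"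
      using lipschitz_functions_totally_bounded[OF \<open>compact X\<close> \<open>0 < d\<close>] by metis
    have "\<forall>g\<in>G. \<exists>N. \<forall>m\<ge>N. \<forall>n\<ge>N. dist (?A g m) (?A g n) < d"
      using G(2) conv \<open>0 < d\<close> convergent_Cauchy metric_CauchyD by metis
    then obtain N where N: "\<And>g m n. g \<in> G \<Longrightarrow> N g \<le> m \<Longrightarrow> N g \<le> n \<Longrightarrow> dist (?A g m) (?A g n) < d"
      by metis
    \<comment> \<open>A maximiser \<open>f\<close> at time \<open>n\<close> is replaced by a nearby
      \<open>g\<close> from \<open>G\<close>, whose averages have settled; weak duality at time
      \<open>m\<close> then bounds the value for \<open>g\<close>. The loss stays below
      \<open>3 * d\<close>, hence below \<open>e\<close>.\<close>
    have le: "F_avg T x y n \<le> F_avg T x y m + 3 * d"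
      if mn: "\<And>g. g \<in> G \<Longrightarrow> N g \<le> m" "\<And>g. g \<in> G \<Longrightarrow> N g \<le> n" for m n
    proof -
      obtain f where f: "1-lipschitz_on X f" "F_avg T x y n \<le> ?A f n"
        using F_avg_attained[of T x X y n] xy by auto
      obtain g where g: "g \<in> G" "\<forall>z\<in>X. \<forall>w\<in>X. \<bar>(f z - g z) - (f w - g w)\<bar> \<le> d"
        using G(3)[OF f(1)] by auto
      have "\<bar>?A f n - ?A g n\<bar> \<le> d"
        using xy g(2) \<open>0 < d\<close> by (intro avg_diff_close[of _ X]) auto
      moreover have "dist (?A g m) (?A g n) < d"
        using N g(1) mn by blast
      moreover have "?A g m \<le> F_avg T x y m"
        using avg_diff_le_F_avg[of T x X y g m] xy G(2) g(1) by auto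
      ultimately show ?thesis
        using f(2) \<open>0 < d\<close> unfolding dist_real_def by linarith
    qed
    show "\<exists>M. \<forall>m\<ge>M. \<forall>n\<ge>M. dist (F_avg T x y m) (F_avg T x y n) < e"
    \<comment> \<open>Finiteness of \<open>G\<close> gives a common threshold; inserting 0 keeps
      \<open>Max\<close> meaningful even for empty \<open>G\<close>.\<close>
    proof (intro exI[of _ "Max (insert 0 (N ` G))"] allI impI)
      fix m n assume "Max (insert 0 (N ` G)) \<le> m" "Max (insert 0 (N ` G)) \<le> n"
      then have "\<And>g. g \<in> G \<Longrightarrow> N g \<le> m" "\<And>g. g \<in> G \<Longrightarrow> N g \<le> n"
        using G(1) by auto
      then show "dist (F_avg T x y m) (F_avg T x y n) < e"
        using le[of m n] le[of n m] \<open>0 < d\<close> by (simp add: dist_real_def d_def abs_less_iff)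
    qed
  qed
  then show ?thesis
    by (rule Cauchy_convergent)
qed

end
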